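(* Let $E$ be a Banach space failing the Grothendieck property. Then the set of weak$^*$-null non-weakly null sequences in $E^*$ is almost pointwise spaceable in $\ell_\infty(E^* )$. Furthermore, given a seminormalized weak$^*$-null non-weakly null $E^*$-valued sequence $\mathbf{x}^*$, there is a closed infinite dimensional subspace of $\ell_\infty(E^* )$ consisting, up to the origin, of weak$^*$-null non-weakly null sequences and containing $\mathbf{x}^*$.
   Context: Banach spaces are real or complex; $E^*$ is the topological dual of $E$. A Banach space has the Grothendieck property if weak$^*$-null sequences in its dual are weakly null. $\ell_\infty(E^* )$ is the Banach space of bounded $E^*$-valued sequences with the supremum norm. A Banach sequence space is a linear subspace of $E^{\mathbb{N}}$, for some Banach space $E$, endowed with a complete norm. A nonempty subset $B$ of a Banach sequence space $X$ is almost pointwise spaceable (in $X$) if for every sequence $\mathbf{x} \in B$ there exists a closed infinite dimensional subspace of $X$ contained in $B \cup \{0\}$ and containing a subsequence of $\mathbf{x}$. A sequence $(x_j)_{j=1}^\infty$ is seminormalized if $0 < \inf_j \|x_j\| \leq \sup_j\|x_j\| < \infty$. *)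

theory Defs
  imports "HOL-Analysis.Analysis" "HOL-Library.Function_Algebras"
begin

text \<open>
  Real and complex Banach spaces are treated uniformly. By Mazur's theorem, the complete
  \<open>real_normed_field\<close>s are exactly the reals and the complex numbers, so the scalar field is a type
  variable \<open>'k :: {real_normed_field, banach}\<close>. A Banach space over \<open>'k\<close> is a type of class
  \<open>banach\<close> (the underlying real Banach space) with a scalar multiplication by \<open>'k\<close> that
  extends \<open>scaleR\<close> and for which the norm is homogeneous.
\<close>

locale banach_space_over = vector_space smul
  for smul :: "'k::{real_normed_field, banach} \<Rightarrow> 'e::banach \<Rightarrow> 'e" +
  assumes smul_of_real: "smul (of_real r) x = r *\<^sub>R x"
    and norm_smul: "norm (smul c x) = norm c * norm x"

text \<open>
  The arrow \<open>\<Rightarrow>\<^sub>L\<close> only enforces real linearity; linearity over \<open>'k\<close> is imposed separately, which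
  makes the dual a subset of the type \<open>'e \<Rightarrow>\<^sub>L 'k\<close>. The norm of that type is the usual dual norm.
\<close>

definition dual :: "('k::{real_normed_field, banach} \<Rightarrow> 'e::banach \<Rightarrow> 'e) \<Rightarrow> ('e \<Rightarrow>\<^sub>L 'k) set"
  where "dual smul = {f. \<forall>c x. blinfun_apply f (smul c x) = c * blinfun_apply f x}"

definition dual_scale ::
  "'k::{real_normed_field, banach} \<Rightarrow> ('e::banach \<Rightarrow>\<^sub>L 'k) \<Rightarrow> ('e \<Rightarrow>\<^sub>L 'k)"
  where "dual_scale c f = blinfun_mult_right c o\<^sub>L f"

lemma dual_scale_apply [simp]: "blinfun_apply (dual_scale c f) x = c * blinfun_apply f x"
  by (simp add: dual_scale_def)

definition weak_star_null :: "(nat \<Rightarrow> 'e::banach \<Rightarrow>\<^sub>L 'k::{real_normed_field, banach}) \<Rightarrow> bool"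
  where "weak_star_null f \<longleftrightarrow> (\<forall>x. (\<lambda>n. blinfun_apply (f n) x) \<longlonglongrightarrow> 0)"

text \<open>
  The continuous linear functionals on a subspace \<open>V\<close> of an ambient type; their values outside \<open>V\<close>
  are irrelevant.
\<close>

definition functionals_on ::
  "('k::real_normed_field \<Rightarrow> 'v::real_normed_vector \<Rightarrow> 'v) \<Rightarrow> 'v set \<Rightarrow> ('v \<Rightarrow> 'k) set"
  where "functionals_on smul V = {\<phi>. continuous_on V \<phi> \<and>
    (\<forall>u\<in>V. \<forall>v\<in>V. \<phi> (u + v) = \<phi> u + \<phi> v) \<and> (\<forall>c. \<forall>v\<in>V. \<phi> (smul c v) = c * \<phi> v)}"

definition weakly_null_on ::
  "('k::real_normed_field \<Rightarrow> 'v::real_normed_vector \<Rightarrow> 'v) \<Rightarrow> 'v set \<Rightarrow> (nat \<Rightarrow> 'v) \<Rightarrow> bool"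
  where "weakly_null_on smul V x \<longleftrightarrow> (\<forall>\<phi>\<in>functionals_on smul V. (\<lambda>n. \<phi> (x n)) \<longlonglongrightarrow> 0)"

definition grothendieck_property ::
  "('k::{real_normed_field, banach} \<Rightarrow> 'e::banach \<Rightarrow> 'e) \<Rightarrow> bool"
  where "grothendieck_property smul \<longleftrightarrow>
    (\<forall>f. range f \<subseteq> dual smul \<and> weak_star_null f \<longrightarrow> weakly_null_on dual_scale (dual smul) f)"

definition weak_star_null_not_weakly_null ::
  "('k::{real_normed_field, banach} \<Rightarrow> 'e::banach \<Rightarrow> 'e) \<Rightarrow> (nat \<Rightarrow> 'e \<Rightarrow>\<^sub>L 'k) set"
  where "weak_star_null_not_weakly_null smul =
    {f. range f \<subseteq> dual smul \<and> weak_star_null f \<and> \<not> weakly_null_on dual_scale (dual smul) f}"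

definition seminormalized :: "(nat \<Rightarrow> 'v::real_normed_vector) \<Rightarrow> bool"
  where "seminormalized x \<longleftrightarrow>
    0 < (INF j. norm (x j)) \<and> bdd_above (range (\<lambda>j. norm (x j)))"

text \<open>
  A Banach sequence space is given by its set \<open>X\<close> of sequences, with the pointwise operations, and
  a norm \<open>N\<close> which is only meaningful on \<open>X\<close>.
\<close>

definition seq_scale :: "('k \<Rightarrow> 'v \<Rightarrow> 'v) \<Rightarrow> 'k \<Rightarrow> (nat \<Rightarrow> 'v) \<Rightarrow> (nat \<Rightarrow> 'v)"
  where "seq_scale smul c x = (\<lambda>n. smul c (x n))"

text \<open>
  \<open>Metric_space\<close> demands nonnegativity and symmetry of the distance even off its carrier, where \<open>N\<close>
  is uncontrolled; hence the case distinction.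
\<close>

definition norm_dist ::
  "(nat \<Rightarrow> 'v::ab_group_add) set \<Rightarrow> ((nat \<Rightarrow> 'v) \<Rightarrow> real) \<Rightarrow> (nat \<Rightarrow> 'v) \<Rightarrow> (nat \<Rightarrow> 'v) \<Rightarrow> real"
  where "norm_dist X N x y = (if x \<in> X \<and> y \<in> X then N (x - y) else 0)"

definition closed_infinite_dim_subspace ::
  "('k::field \<Rightarrow> 'v::ab_group_add \<Rightarrow> 'v) \<Rightarrow> (nat \<Rightarrow> 'v) set \<Rightarrow> ((nat \<Rightarrow> 'v) \<Rightarrow> real) \<Rightarrow>
    (nat \<Rightarrow> 'v) set \<Rightarrow> bool"
  where "closed_infinite_dim_subspace smul X N W \<longleftrightarrow>
    W \<subseteq> X \<and> module.subspace (seq_scale smul) W \<and>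
    closedin (Metric_space.mtopology X (norm_dist X N)) W \<and>
    \<not> (\<exists>S. finite S \<and> module.span (seq_scale smul) S = W)"

definition almost_pointwise_spaceable ::
  "('k::field \<Rightarrow> 'v::ab_group_add \<Rightarrow> 'v) \<Rightarrow> (nat \<Rightarrow> 'v) set \<Rightarrow> ((nat \<Rightarrow> 'v) \<Rightarrow> real) \<Rightarrow>
    (nat \<Rightarrow> 'v) set \<Rightarrow> bool"
  where "almost_pointwise_spaceable smul X N B \<longleftrightarrow>
    B \<noteq> {} \<and> B \<subseteq> X \<and>
    (\<forall>x\<in>B. \<exists>W. closed_infinite_dim_subspace smul X N W \<and> W \<subseteq> B \<union> {0} \<and>
      (\<exists>r. strict_mono r \<and> x \<circ> r \<in> W))"

definition ell_infinity :: "'v::real_normed_vector set \<Rightarrow> (nat \<Rightarrow> 'v) set"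
  where "ell_infinity V = {x. range x \<subseteq> V \<and> bounded (range x)}"

definition sup_norm :: "(nat \<Rightarrow> 'v::real_normed_vector) \<Rightarrow> real"
  where "sup_norm x = (SUP n. norm (x n))"

lemma bdd_above_norm_diff_ell_infinity:
  assumes "x \<in> ell_infinity V" "y \<in> ell_infinity V"
  shows "bdd_above (range (\<lambda>n. norm (x n - y n)))"
proof -
  from assms obtain a b where "\<And>n. norm (x n) \<le> a" "\<And>n. norm (y n) \<le> b"
    by (fastforce simp: ell_infinity_def bounded_iff)
  then have "norm (x n - y n) \<le> a + b" for n
    by (meson add_mono norm_triangle_ineq4 order_trans)
  then show ?thesis
    by (intro bdd_aboveI2)
qed

lemma norm_le_sup_norm_diff:
  assumes "x \<in> ell_infinity V" "y \<in> ell_infinity V"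
  shows "norm (x n - y n) \<le> sup_norm (x - y)"
  unfolding sup_norm_def using cSUP_upper[OF _ bdd_above_norm_diff_ell_infinity[OF assms]] by simp

lemma Metric_space_ell_infinity:
  "Metric_space (ell_infinity V) (norm_dist (ell_infinity V) sup_norm)"
proof
  show "0 \<le> norm_dist (ell_infinity V) sup_norm x y" for x y
    using order_trans[OF norm_ge_zero norm_le_sup_norm_diff[of x V y]] by (simp add: norm_dist_def)
  have "sup_norm (x - y) = sup_norm (y - x)" for x y :: "nat \<Rightarrow> 'a"
    by (simp add: sup_norm_def norm_minus_commute)
  then show "norm_dist (ell_infinity V) sup_norm x y = norm_dist (ell_infinity V) sup_norm y x"
    for x y
    by (simp add: norm_dist_def)
next
  fix x y assume xy: "x \<in> ell_infinity V" "y \<in> ell_infinity V"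
  have "x = y" if "sup_norm (x - y) = 0"
    using norm_le_sup_norm_diff[OF xy] that by (auto simp: fun_eq_iff)
  then show "norm_dist (ell_infinity V) sup_norm x y = 0 \<longleftrightarrow> x = y"
    using xy by (auto simp: norm_dist_def sup_norm_def)
next
  fix x y z
  assume xyz: "x \<in> ell_infinity V" "y \<in> ell_infinity V" "z \<in> ell_infinity V"
  have "norm (x n - z n) \<le> sup_norm (x - y) + sup_norm (y - z)" for n
    using norm_le_sup_norm_diff[of x V y n] norm_le_sup_norm_diff[of y V z n] xyz
      norm_triangle_ineq[of "x n - y n" "y n - z n"] by simp
  then have "sup_norm (x - z) \<le> sup_norm (x - y) + sup_norm (y - z)"
    unfolding sup_norm_def[of "x - z"] by (intro cSUP_least) auto
  then show "norm_dist (ell_infinity V) sup_norm x z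
      \<le> norm_dist (ell_infinity V) sup_norm x y + norm_dist (ell_infinity V) sup_norm y z"
    using xyz by (simp add: norm_dist_def)
qed

lemma mcomplete_ell_infinity:
  fixes V :: "'v::banach set"
  assumes "closed V"
  shows "Metric_space.mcomplete (ell_infinity V) (norm_dist (ell_infinity V) sup_norm)"
proof -
  interpret M: Metric_space "ell_infinity V" "norm_dist (ell_infinity V) sup_norm"
    by (rule Metric_space_ell_infinity)
  show ?thesis
    unfolding M.mcomplete_def
  proof (intro allI impI)
    fix \<sigma> assume "M.MCauchy \<sigma>"
    then have \<sigma>: "\<sigma> k \<in> ell_infinity V" for k
      by (auto simp: M.MCauchy_def)
    have cau: "\<exists>K. \<forall>k\<ge>K. \<forall>l\<ge>K. \<forall>n. norm (\<sigma> k n - \<sigma> l n) < e" if "0 < e" for e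
    proof -
      obtain K where "\<forall>k l. K \<le> k \<longrightarrow> K \<le> l \<longrightarrow> norm_dist (ell_infinity V) sup_norm (\<sigma> k) (\<sigma> l) < e"
        using \<open>M.MCauchy \<sigma>\<close> \<open>0 < e\<close> unfolding M.MCauchy_def by blast
      then have "\<forall>k\<ge>K. \<forall>l\<ge>K. sup_norm (\<sigma> k - \<sigma> l) < e"
        using \<sigma> by (simp add: norm_dist_def)
      then show ?thesis
        using norm_le_sup_norm_diff[OF \<sigma> \<sigma>] le_less_trans by blast
    qed
    then have "Cauchy (\<lambda>k. \<sigma> k n)" for n
      unfolding Cauchy_def dist_norm by blast
    then have "\<exists>l. (\<lambda>k. \<sigma> k n) \<longlonglongrightarrow> l" for n
      by (auto simp: Cauchy_convergent_iff convergent_def)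
    then obtain l where l: "\<And>n. (\<lambda>k. \<sigma> k n) \<longlonglongrightarrow> l n"
      by metis
    have close: "\<exists>K. \<forall>k\<ge>K. \<forall>n. norm (\<sigma> k n - l n) \<le> e" if "0 < e" for e
    proof -
      obtain K where K: "\<forall>k\<ge>K. \<forall>l\<ge>K. \<forall>n. norm (\<sigma> k n - \<sigma> l n) < e"
        using cau[OF \<open>0 < e\<close>] by blast
      have "norm (\<sigma> k n - l n) \<le> e" if "K \<le> k" for k n
      proof (rule tendsto_upperbound)
        show "(\<lambda>j. norm (\<sigma> k n - \<sigma> j n)) \<longlonglongrightarrow> norm (\<sigma> k n - l n)"
          by (intro tendsto_intros l)
        show "\<forall>\<^sub>F j in sequentially. norm (\<sigma> k n - \<sigma> j n) \<le> e"
          unfolding eventually_sequentially using K that less_imp_le by blast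
      qed simp
      then show ?thesis by blast
    qed
    have "\<sigma> k n \<in> V" for k n
      using \<sigma>[of k] by (auto simp: ell_infinity_def)
    then have "l n \<in> V" for n
      using closed_sequentially[OF assms _ l] by blast
    moreover have "bounded (range l)"
    proof -
      obtain K where K: "\<And>n. norm (\<sigma> K n - l n) \<le> 1"
        using close[of 1] by auto
      obtain b where b: "\<And>n. norm (\<sigma> K n) \<le> b"
        using \<sigma>[of K] by (auto simp: ell_infinity_def bounded_iff)
      have "norm (l n) \<le> b + 1" for n
        using K[of n] b[of n] norm_triangle_ineq3[of "\<sigma> K n" "l n"] by linarith
      then show ?thesis by (auto simp: bounded_iff)
    qed
    ultimately have lX: "l \<in> ell_infinity V"
      by (auto simp: ell_infinity_def)
    have "\<exists>K. \<forall>k\<ge>K. norm_dist (ell_infinity V) sup_norm (\<sigma> k) l < e" if e: "0 < e" for e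
    proof -
      obtain K where K: "\<forall>k\<ge>K. \<forall>n. norm (\<sigma> k n - l n) \<le> e / 2"
        using close[of "e / 2"] e by auto
      have half: "sup_norm (\<sigma> k - l) \<le> e / 2" if "K \<le> k" for k
        unfolding sup_norm_def using K that by (intro cSUP_least) auto
      then have "norm_dist (ell_infinity V) sup_norm (\<sigma> k) l < e" if "K \<le> k" for k
        using half[OF that] e \<sigma> lX by (simp add: norm_dist_def)
      then show ?thesis by blast
    qed
    then show "\<exists>x. limitin M.mtopology \<sigma> x sequentially"
      using lX \<sigma> by (auto simp: M.limitin_metric eventually_sequentially)
  qed
qed

lemma closed_dual: "closed (dual smul)"
proof -
  have "dual smul = (\<Inter>c x. {f. blinfun_apply f (smul c x) = c * blinfun_apply f x})"
    by (auto simp: dual_def)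
  then show ?thesis
    by (auto intro!: closed_INT closed_Collect_eq continuous_intros)
qed

end

theory Submission
  imports Defs
begin

text \<open>
  Let \<open>x\<close> be a seminormalized weak* null sequence of functionals and \<open>\<phi>\<close> a functional on the dual
  with \<open>norm (\<phi> (x n)) \<ge> \<delta> > 0\<close> for all \<open>n\<close> in an infinite set \<open>A\<close>. Cut the index set into
  infinitely many blocks, each of which meets \<open>A\<close> in an infinite set, and multiply \<open>x\<close> by bounded
  scalar sequences that are constant on every block. Since \<open>x\<close> is bounded below and above in norm,
  this maps the bounded scalar sequences isomorphically onto a closed subspace, which contains \<open>x\<close>
  (all scalars equal to \<open>1\<close>) and has infinite dimension (one independent element for each block);
  see \<open>closed_infinite_dim_subspace_block_multiples\<close>.
  Bounded scalars preserve weak* nullity, and a nonzero scalar \<open>c\<close> on one block keeps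
  \<open>norm (\<phi> (dual_scale c (x n))) \<ge> norm c * \<delta>\<close> at infinitely many \<open>n\<close>, so no nonzero element of
  the subspace is weakly null. This is \<open>seminormalized_mem_closed_infinite_dim_subspace\<close>.

  A general weak* null sequence that is not weakly null is bounded by the uniform boundedness
  principle, and by continuity of \<open>\<phi>\<close> its terms with \<open>norm (\<phi> (x n)) \<ge> \<delta>\<close> are bounded away from
  \<open>0\<close>. These terms form a seminormalized subsequence of the same kind
  (\<open>seminormalized_subsequence\<close>), so almost pointwise spaceability follows from the seminormalized
  case.
\<close>

section \<open>Scaling of functionals\<close>

lemma norm_dual_scale:
  fixes f :: "'e::banach \<Rightarrow>\<^sub>L 'k::{real_normed_field, banach}"
  shows "norm (dual_scale c f) = norm c * norm f"
proof (rule antisym)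
  have le: "norm (dual_scale b g) \<le> norm b * norm g" for b and g :: "'e \<Rightarrow>\<^sub>L 'k"
    by (intro norm_blinfun_bound)
      (auto simp: norm_mult mult.assoc intro!: mult_left_mono norm_blinfun)
  show "norm (dual_scale c f) \<le> norm c * norm f"
    by (rule le)
  show "norm c * norm f \<le> norm (dual_scale c f)"
  proof (cases "c = 0")
    case False
    have "f = dual_scale (inverse c) (dual_scale c f)"
      using False by (intro blinfun_eqI) simp
    then have "norm f \<le> norm (inverse c) * norm (dual_scale c f)"
      by (metis le)
    then show ?thesis
      using False by (simp add: norm_inverse norm_divide field_simps)
  qed simp
qed

lemma dual_scale_one [simp]: "dual_scale 1 f = f"
  and dual_scale_zero [simp]: "dual_scale 0 f = 0"
  and dual_scale_eq_zero_iff: "dual_scale c f = 0 \<longleftrightarrow> c = 0 \<or> f = 0"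
proof -
  show "dual_scale 1 f = f"
    by (rule blinfun_eqI) simp
  show "dual_scale 0 f = 0"
    by (rule blinfun_eqI) simp
  show "dual_scale c f = 0 \<longleftrightarrow> c = 0 \<or> f = 0"
    by (metis norm_dual_scale mult_eq_0_iff norm_eq_zero)
qed

lemma dual_scale_mem_dual: "f \<in> dual smul \<Longrightarrow> dual_scale c f \<in> dual smul"
  by (simp add: dual_def mult.left_commute)

lemma zero_mem_dual: "0 \<in> dual smul"
  and add_mem_dual: "f \<in> dual smul \<Longrightarrow> g \<in> dual smul \<Longrightarrow> f + g \<in> dual smul"
  by (simp_all add: dual_def blinfun.add_left distrib_left)

lemma dual_scale_add_left: "dual_scale (a + b) f = dual_scale a f + dual_scale b f"
  and dual_scale_dual_scale: "dual_scale a (dual_scale b f) = dual_scale (a * b) f"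
  and dual_scale_diff_left: "dual_scale (a - b) f = dual_scale a f - dual_scale b f"
  by (rule blinfun_eqI, simp add: blinfun.add_left blinfun.diff_left algebra_simps)+

lemma vector_space_seq_scale_dual_scale: "vector_space (seq_scale dual_scale)"
  by unfold_locales
    (auto simp: seq_scale_def fun_eq_iff intro!: blinfun_eqI
      simp: blinfun.add_left blinfun.add_right algebra_simps)

section \<open>Uniform boundedness\<close>

text \<open>
  By Baire's theorem one of the closed sets on which the sequence is bounded by a fixed natural
  number contains a ball; the bound on the ball translates into a bound on the norms.
\<close>

theorem uniform_boundedness:
  fixes f :: "nat \<Rightarrow> 'a::banach \<Rightarrow>\<^sub>L 'b::real_normed_vector"
  assumes "\<And>x. bounded (range (\<lambda>n. f n x))"
  shows "bounded (range f)"
proof -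
  define C where "C k = {x. \<forall>n. norm (f n x) \<le> real k}" for k :: nat
  have closed: "closed (C k)" for k
  proof -
    have "C k = (\<Inter>n. {x. norm (f n x) \<le> real k})"
      by (auto simp: C_def)
    then show ?thesis
      by (auto intro!: closed_INT closed_Collect_le continuous_intros)
  qed
  have "x \<in> \<Union>(range C)" for x
  proof -
    obtain b where b: "\<And>n. norm (f n x) \<le> b"
      using assms[of x] by (auto simp: bounded_iff)
    obtain k where "b \<le> real k"
      using real_arch_simple by blast
    then have "x \<in> C k"
      using order_trans[OF b] by (simp add: C_def)
    then show ?thesis
      by blast
  qed
  then have "\<Union>(range C) = UNIV"
    by blast
  moreover have "euclidean interior_of \<Union>(range C) = {}" if "\<And>k. interior (C k) = {}"
    by (rule Baire_category_alt)
      (use that closed in \<open>auto simp: completely_metrizable_space_euclidean\<close>)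
  ultimately obtain k a where "a \<in> interior (C k)"
    by fastforce
  then obtain e where e: "0 < e" "cball a e \<subseteq> C k"
    using mem_interior_cball by blast
  have "norm (f n x) \<le> (2 * real k / e) * norm x" for n x
  proof (cases "x = 0")
    case False
    define u where "u = (e / norm x) *\<^sub>R x"
    have "norm u = e"
      using False e by (simp add: u_def)
    then have "a + u \<in> cball a e" "a \<in> cball a e"
      using e by (auto simp: dist_norm)
    then have "a + u \<in> C k" "a \<in> C k"
      using e(2) by blast+
    then have "norm (f n (a + u)) \<le> real k" "norm (f n a) \<le> real k"
      by (simp_all add: C_def)
    then have "norm (f n u) \<le> 2 * real k"
      using norm_triangle_ineq4[of "f n (a + u)" "f n a"] by (simp add: blinfun.add_right)
    then have "(e / norm x) * norm (f n x) \<le> 2 * real k"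
      using e by (simp add: u_def blinfun.scaleR_right)
    then show ?thesis
      using False e by (simp add: field_simps)
  qed simp
  then have "norm (f n) \<le> 2 * real k / e" for n
    using e by (intro norm_blinfun_bound) auto
  then show ?thesis
    by (auto simp: bounded_iff)
qed

lemma weak_star_null_bounded: "weak_star_null f \<Longrightarrow> bounded (range f)"
  by (rule uniform_boundedness) (auto simp: weak_star_null_def intro: convergent_imp_bounded)

section \<open>Multiples that are constant on blocks\<close>

text \<open>
  The map \<open>i\<close> assigns to every index its block. Membership in \<open>X\<close> encodes boundedness: if \<open>x\<close> is
  bounded below in norm and \<open>X\<close> consists of bounded sequences, the coefficients \<open>a\<close> are bounded too.
\<close>

definition block_multiples ::
  "(nat \<Rightarrow> nat) \<Rightarrow> (nat \<Rightarrow> 'e::banach \<Rightarrow>\<^sub>L 'k::{real_normed_field, banach}) \<Rightarrow>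
    (nat \<Rightarrow> 'e \<Rightarrow>\<^sub>L 'k) set \<Rightarrow> (nat \<Rightarrow> 'e \<Rightarrow>\<^sub>L 'k) set"
  where "block_multiples i x X = {z \<in> X. \<exists>a. \<forall>n. z n = dual_scale (a (i n)) (x n)}"

lemma mem_block_multiplesI:
  "z \<in> X \<Longrightarrow> (\<And>n. z n = dual_scale (a (i n)) (x n)) \<Longrightarrow> z \<in> block_multiples i x X"
  by (auto simp: block_multiples_def)

lemma seminormalizedD:
  assumes "seminormalized x"
  shows "\<exists>c>0. \<forall>n. c \<le> norm (x n)" and "bounded (range x)"
proof -
  have "(INF j. norm (x j)) \<le> norm (x n)" for n
    by (rule cINF_lower) (auto intro: bdd_belowI2[where m = 0])
  then show "\<exists>c>0. \<forall>n. c \<le> norm (x n)"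
    using assms by (auto simp: seminormalized_def)
  show "bounded (range x)"
    using assms by (auto simp: seminormalized_def bounded_iff bdd_above_def)
qed

lemma subspace_ell_infinity_dual:
  "module.subspace (seq_scale dual_scale) (ell_infinity (dual smul))"
proof -
  interpret S: vector_space "seq_scale dual_scale :: 'a \<Rightarrow> (nat \<Rightarrow> 'b \<Rightarrow>\<^sub>L 'a) \<Rightarrow> _"
    by (rule vector_space_seq_scale_dual_scale)
  show ?thesis
  proof (rule S.subspaceI)
    show "0 \<in> ell_infinity (dual smul)"
      by (auto simp: ell_infinity_def zero_mem_dual)
  next
    fix y z
    assume "y \<in> ell_infinity (dual smul)" "z \<in> ell_infinity (dual smul)"
    then show "y + z \<in> ell_infinity (dual smul)"
      using bounded_plus_comp[of y UNIV z]
      by (auto simp: ell_infinity_def plus_fun_def intro!: add_mem_dual)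
  next
    fix c y
    assume y: "y \<in> ell_infinity (dual smul)"
    then obtain b where "\<And>n. norm (y n) \<le> b"
      by (auto simp: ell_infinity_def bounded_iff)
    then have "norm (dual_scale c (y n)) \<le> norm c * b" for n
      by (simp add: norm_dual_scale mult_left_mono)
    then show "seq_scale dual_scale c y \<in> ell_infinity (dual smul)"
      using y by (auto simp: ell_infinity_def seq_scale_def dual_scale_mem_dual bounded_iff)
  qed
qed

lemma subspace_block_multiples:
  assumes "module.subspace (seq_scale dual_scale) X"
  shows "module.subspace (seq_scale dual_scale) (block_multiples i x X)"
proof -
  interpret S: vector_space "seq_scale dual_scale :: 'a \<Rightarrow> (nat \<Rightarrow> 'b \<Rightarrow>\<^sub>L 'a) \<Rightarrow> _"
    by (rule vector_space_seq_scale_dual_scale)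
  show ?thesis
  proof (rule S.subspaceI)
    show "0 \<in> block_multiples i x X"
      by (rule mem_block_multiplesI[where a = "\<lambda>_. 0"]) (simp_all add: S.subspace_0[OF assms])
  next
    fix y z
    assume y: "y \<in> block_multiples i x X" and z: "z \<in> block_multiples i x X"
    obtain a b where "\<And>n. y n = dual_scale (a (i n)) (x n)" "\<And>n. z n = dual_scale (b (i n)) (x n)"
      using y z by (auto simp: block_multiples_def)
    then show "y + z \<in> block_multiples i x X"
      using y z S.subspace_add[OF assms]
      by (intro mem_block_multiplesI[where a = "\<lambda>j. a j + b j"])
        (auto simp: block_multiples_def dual_scale_add_left)
  next
    fix c y
    assume y: "y \<in> block_multiples i x X"
    then obtain a where a: "\<And>n. y n = dual_scale (a (i n)) (x n)" and "y \<in> X"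
      by (auto simp: block_multiples_def)
    show "seq_scale dual_scale c y \<in> block_multiples i x X"
    proof (rule mem_block_multiplesI)
      show "seq_scale dual_scale c y \<in> X"
        using S.subspace_scale[OF assms \<open>y \<in> X\<close>] .
      show "seq_scale dual_scale c y n = dual_scale (c * a (i n)) (x n)" for n
        by (simp add: seq_scale_def a dual_scale_dual_scale)
    qed
  qed
qed

text \<open>
  The values of two multiples at an index \<open>n\<close> of a block are \<open>norm (x n)\<close> times as far apart as their
  coefficients there. Hence the coefficients of a pointwise convergent sequence of multiples are
  Cauchy, and their limits are the coefficients of the limit.
\<close>

lemma pointwise_limit_block_multiple:
  fixes x :: "nat \<Rightarrow> 'e::banach \<Rightarrow>\<^sub>L 'k::{real_normed_field, banach}"
  assumes nz: "\<And>n. x n \<noteq> 0"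
    and \<sigma>: "\<And>k. \<sigma> k \<in> block_multiples i x X"
    and lim: "\<And>n. (\<lambda>k. \<sigma> k n) \<longlonglongrightarrow> l n"
    and "l \<in> X"
  shows "l \<in> block_multiples i x X"
proof -
  have "\<exists>a. \<forall>n. \<sigma> k n = dual_scale (a (i n)) (x n)" for k
    using \<sigma>[of k] by (simp add: block_multiples_def)
  then obtain a where a: "\<And>k n. \<sigma> k n = dual_scale (a k (i n)) (x n)"
    by metis
  have "\<exists>b. (\<lambda>k. a k (i n)) \<longlonglongrightarrow> b" for n
  proof -
    have "Cauchy (\<lambda>k. a k (i n))"
      unfolding Cauchy_def
    proof (intro allI impI)
      fix e :: real
      assume "0 < e"
      then have "0 < e * norm (x n)"
        using nz by simp
      moreover have "Cauchy (\<lambda>k. \<sigma> k n)"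
        using lim by (blast intro: LIMSEQ_imp_Cauchy)
      ultimately obtain K where
        "\<And>k l. K \<le> k \<Longrightarrow> K \<le> l \<Longrightarrow> norm (\<sigma> k n - \<sigma> l n) < e * norm (x n)"
        unfolding Cauchy_def dist_norm by metis
      then show "\<exists>K. \<forall>k\<ge>K. \<forall>l\<ge>K. dist (a k (i n)) (a l (i n)) < e"
        using nz[of n]
        by (auto simp: a dist_norm norm_dual_scale simp flip: dual_scale_diff_left)
    qed
    then show ?thesis
      by (simp add: Cauchy_convergent_iff convergent_def)
  qed
  then have "\<exists>b. \<forall>n. (\<lambda>k. a k (i n)) \<longlonglongrightarrow> b (i n)"
    by (intro exI[of _ "\<lambda>j. lim (\<lambda>k. a k j)"]) (metis limI)
  then obtain b where b: "\<And>n. (\<lambda>k. a k (i n)) \<longlonglongrightarrow> b (i n)"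
    by blast
  have "l n = dual_scale (b (i n)) (x n)" for n
  proof (rule blinfun_eqI)
    fix v
    have "(\<lambda>k. \<sigma> k n v) \<longlonglongrightarrow> l n v"
      by (intro tendsto_intros lim)
    moreover have "(\<lambda>k. \<sigma> k n v) \<longlonglongrightarrow> dual_scale (b (i n)) (x n) v"
      unfolding a dual_scale_apply by (intro tendsto_intros b)
    ultimately show "l n v = dual_scale (b (i n)) (x n) v"
      by (rule LIMSEQ_unique)
  qed
  with \<open>l \<in> X\<close> show ?thesis
    by (intro mem_block_multiplesI)
qed

lemma limitin_ell_infinity_imp_pointwise:
  assumes "limitin (Metric_space.mtopology (ell_infinity V) (norm_dist (ell_infinity V) sup_norm))
      \<sigma> l sequentially"
    and \<sigma>: "\<And>k. \<sigma> k \<in> ell_infinity V"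
  shows "l \<in> ell_infinity V" and "(\<lambda>k. \<sigma> k n) \<longlonglongrightarrow> l n"
proof -
  interpret M: Metric_space "ell_infinity V" "norm_dist (ell_infinity V) sup_norm"
    by (rule Metric_space_ell_infinity)
  show l: "l \<in> ell_infinity V"
    using assms by (simp add: M.limitin_metric_dist_null)
  have "(\<lambda>k. sup_norm (\<sigma> k - l)) \<longlonglongrightarrow> 0"
    using assms l by (simp add: M.limitin_metric_dist_null norm_dist_def)
  then have "(\<lambda>k. \<sigma> k n - l n) \<longlonglongrightarrow> 0"
    by (rule Lim_null_comparison[rotated]) (simp add: norm_le_sup_norm_diff[OF \<sigma> l])
  then show "(\<lambda>k. \<sigma> k n) \<longlonglongrightarrow> l n"
    by (simp add: LIM_zero_iff)
qed

text \<open>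
  The restrictions of \<open>x\<close> to the single blocks lie in the subspace. None of them is in the span of
  the others, because those all vanish on its block.
\<close>

lemma block_multiples_not_finitely_spanned:
  fixes x :: "nat \<Rightarrow> 'e::banach \<Rightarrow>\<^sub>L 'k::{real_normed_field, banach}"
  assumes nz: "\<And>n. x n \<noteq> 0" and surj: "surj i"
    and x: "x \<in> ell_infinity (dual smul)" and "finite S"
  shows "module.span (seq_scale dual_scale) S \<noteq> block_multiples i x (ell_infinity (dual smul))"
proof
  interpret S: vector_space "seq_scale dual_scale :: 'k \<Rightarrow> (nat \<Rightarrow> 'e \<Rightarrow>\<^sub>L 'k) \<Rightarrow> _"
    by (rule vector_space_seq_scale_dual_scale)
  let ?W = "block_multiples i x (ell_infinity (dual smul))"
  assume span: "S.span S = ?W"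
  define u where "u j n = (if i n = j then x n else 0)" for j n
  obtain b where b: "\<And>n. norm (x n) \<le> b"
    using x by (auto simp: ell_infinity_def bounded_iff)
  have "norm (u j n) \<le> b" for j n
    using b[of n] order_trans[OF norm_ge_zero b] by (simp add: u_def)
  then have "bounded (range (u j))" for j
    by (auto simp: bounded_iff)
  moreover have "range (u j) \<subseteq> dual smul" for j
    using x by (auto simp: ell_infinity_def u_def zero_mem_dual)
  ultimately have "u j \<in> ell_infinity (dual smul)" for j
    by (simp add: ell_infinity_def)
  then have "u j \<in> ?W" for j
    by (rule mem_block_multiplesI[where a = "\<lambda>k. if k = j then 1 else 0"]) (simp add: u_def)
  then have "range u \<subseteq> S.span S"
    using span by auto
  moreover have inj: "inj u"
  proof (rule injI)
    fix j k
    assume eq: "u j = u k"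
    obtain n where "i n = j"
      using surj by (metis surjD)
    then show "j = k"
      using fun_cong[OF eq, of n] nz[of n] by (auto simp: u_def split: if_splits)
  qed
  moreover have "S.independent (range u)"
    unfolding S.dependent_def
  proof clarify
    fix j
    assume j: "u j \<in> S.span (range u - {u j})"
    obtain n where n: "i n = j"
      using surj by (metis surjD)
    have "S.subspace {z. z n = 0}"
      by (rule S.subspaceI) (auto simp: seq_scale_def dual_scale_eq_zero_iff)
    moreover have "range u - {u j} \<subseteq> {z. z n = 0}"
      using n by (auto simp: u_def)
    ultimately have "u j n = 0"
      using S.span_minimal j by blast
    then show False
      using n nz by (simp add: u_def)
  qed
  ultimately have "finite (range u)"
    using S.independent_span_bound[OF \<open>finite S\<close>] by blast
  then show False
    using inj finite_imageD infinite_UNIV_nat by blast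
qed

lemma closed_infinite_dim_subspace_block_multiples:
  assumes nz: "\<And>n. x n \<noteq> 0" and "surj i" and "x \<in> ell_infinity (dual smul)"
  shows "closed_infinite_dim_subspace dual_scale (ell_infinity (dual smul)) sup_norm
    (block_multiples i x (ell_infinity (dual smul)))"
proof -
  let ?X = "ell_infinity (dual smul)"
  interpret M: Metric_space ?X "norm_dist ?X sup_norm"
    by (rule Metric_space_ell_infinity)
  have sub: "block_multiples i x ?X \<subseteq> ?X"
    by (auto simp: block_multiples_def)
  have "closedin M.mtopology (block_multiples i x ?X)"
    unfolding M.metric_closedin_iff_sequentially_closed
  proof (intro conjI allI impI sub, elim conjE)
    fix \<sigma> l
    assume \<sigma>: "range \<sigma> \<subseteq> block_multiples i x ?X" and lim: "limitin M.mtopology \<sigma> l sequentially"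
    then have "\<sigma> k \<in> ?X" for k
      using sub by blast
    note l = limitin_ell_infinity_imp_pointwise[OF lim this]
    show "l \<in> block_multiples i x ?X"
      by (rule pointwise_limit_block_multiple[OF nz _ l(2,1)]) (use \<sigma> in blast)
  qed
  then show ?thesis
    unfolding closed_infinite_dim_subspace_def
    using sub subspace_block_multiples[OF subspace_ell_infinity_dual]
      block_multiples_not_finitely_spanned[OF assms] by blast
qed

section \<open>Nonzero block multiples are not weakly null\<close>

lemma not_tendsto_zeroE:
  fixes f :: "nat \<Rightarrow> 'a::real_normed_vector"
  assumes "\<not> f \<longlonglongrightarrow> 0"
  obtains d where "0 < d" and "infinite {n. d \<le> norm (f n)}"
proof -
  obtain d where "0 < d" "\<And>N. \<exists>n\<ge>N. d \<le> norm (f n)"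
    using assms by (auto simp: LIMSEQ_iff not_less)
  then show thesis
    using that by (auto simp: infinite_nat_iff_unbounded_le)
qed

lemma infinite_imp_not_tendsto_zero:
  fixes f :: "nat \<Rightarrow> 'a::real_normed_vector"
  assumes "0 < d" and inf: "infinite {n. d \<le> norm (f n)}"
  shows "\<not> f \<longlonglongrightarrow> 0"
proof
  assume "f \<longlonglongrightarrow> 0"
  then obtain N where "\<And>n. N \<le> n \<Longrightarrow> norm (f n) < d"
    using \<open>0 < d\<close> by (auto simp: LIMSEQ_iff)
  then show False
    using inf unfolding infinite_nat_iff_unbounded_le by force
qed

text \<open>
  Enumerate \<open>A\<close> and split the enumeration with a pairing function. Indices outside \<open>A\<close> may go to any
  block.
\<close>

lemma ex_blocks_meeting_infinite_set:
  fixes A :: "nat set"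
  assumes "infinite A"
  shows "\<exists>i :: nat \<Rightarrow> nat. \<forall>j. infinite {n \<in> A. i n = j}"
proof (intro exI allI)
  define e where "e = enumerate A"
  have inj: "inj e"
    unfolding e_def by (rule inj_enumerate[OF assms])
  show "infinite {n \<in> A. fst (prod_decode (inv e n)) = j}" for j
  proof
    assume fin: "finite {n \<in> A. fst (prod_decode (inv e n)) = j}"
    have "range (\<lambda>k. e (prod_encode (j, k))) \<subseteq> {n \<in> A. fst (prod_decode (inv e n)) = j}"
      using inj by (auto simp: e_def enumerate_in_set[OF assms])
    moreover have "inj (\<lambda>k. e (prod_encode (j, k)))"
      by (rule injI) (simp add: inj_eq[OF inj])
    ultimately show False
      using finite_imageD[OF finite_subset[OF _ fin]] infinite_UNIV_nat by blast
  qed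
qed

text \<open>
  Since \<open>x\<close> stays away from \<open>0\<close> in norm, boundedness of the multiple forces its scalars to be bounded.
\<close>

lemma weak_star_null_bounded_multiple:
  fixes x :: "nat \<Rightarrow> 'e::banach \<Rightarrow>\<^sub>L 'k::{real_normed_field, banach}"
  assumes "weak_star_null x" and c: "0 < c" "\<And>n. c \<le> norm (x n)"
    and z: "bounded (range z)" "\<And>n. z n = dual_scale (a n) (x n)"
  shows "weak_star_null z"
  unfolding weak_star_null_def
proof
  fix v
  obtain b where b: "\<And>n. norm (z n) \<le> b"
    using z(1) by (auto simp: bounded_iff)
  have "norm (a n) \<le> b / c" for n
  proof -
    have "norm (a n) * c \<le> norm (a n) * norm (x n)"
      using c by (intro mult_left_mono) auto
    also have "\<dots> \<le> b"
      using b[of n] by (simp add: z(2) norm_dual_scale)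
    finally show ?thesis
      using c by (simp add: field_simps)
  qed
  then have "norm (z n v) \<le> norm (x n v) * (b / c)" for n
    unfolding z(2) dual_scale_apply norm_mult
    by (subst mult.commute) (rule mult_left_mono, auto)
  then have "\<forall>\<^sub>F n in sequentially. norm (z n v) \<le> norm (x n v) * (b / c)"
    by simp
  moreover have "(\<lambda>n. x n v) \<longlonglongrightarrow> 0"
    using assms(1) by (simp add: weak_star_null_def)
  ultimately show "(\<lambda>n. z n v) \<longlonglongrightarrow> 0"
    by (rule tendsto_0_le[rotated])
qed

text \<open>
  The blocks are adapted to one functional \<open>\<phi>\<close> that witnesses the failure of weak convergence of \<open>x\<close>;
  the same \<open>\<phi>\<close> then works for all nonzero multiples.
\<close>

theorem seminormalized_mem_closed_infinite_dim_subspace: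
  fixes smul :: "'k::{real_normed_field, banach} \<Rightarrow> 'e::banach \<Rightarrow> 'e"
  assumes x: "x \<in> weak_star_null_not_weakly_null smul" and semi: "seminormalized x"
  shows "\<exists>W. closed_infinite_dim_subspace dual_scale (ell_infinity (dual smul)) sup_norm W \<and>
    W \<subseteq> weak_star_null_not_weakly_null smul \<union> {0} \<and> x \<in> W"
proof -
  let ?X = "ell_infinity (dual smul)"
  obtain c where c: "0 < c" "\<And>n. c \<le> norm (x n)"
    using seminormalizedD(1)[OF semi] by blast
  then have nz: "x n \<noteq> 0" for n
    by (metis norm_zero not_less)
  have dual: "x n \<in> dual smul" for n
    using x by (auto simp: weak_star_null_not_weakly_null_def)
  then have xX: "x \<in> ?X"
    using seminormalizedD(2)[OF semi] by (auto simp: ell_infinity_def)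
  obtain \<phi> where \<phi>: "\<phi> \<in> functionals_on dual_scale (dual smul)" "\<not> (\<lambda>n. \<phi> (x n)) \<longlonglongrightarrow> 0"
    using x by (auto simp: weak_star_null_not_weakly_null_def weakly_null_on_def)
  obtain d where d: "0 < d" and inf: "infinite {n. d \<le> norm (\<phi> (x n))}"
    using not_tendsto_zeroE[OF \<phi>(2)] .
  obtain i :: "nat \<Rightarrow> nat" where i: "\<And>j. infinite {n \<in> {n. d \<le> norm (\<phi> (x n))}. i n = j}"
    using ex_blocks_meeting_infinite_set[OF inf] by blast
  have "surj i"
    unfolding surj_def by (metis not_finite_existsD[OF i])
  moreover have "z \<in> weak_star_null_not_weakly_null smul"
    if z: "z \<in> block_multiples i x ?X" and "z \<noteq> 0" for z
  proof -
    obtain a where a: "\<And>n. z n = dual_scale (a (i n)) (x n)"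
      using z by (auto simp: block_multiples_def)
    have zX: "range z \<subseteq> dual smul" "bounded (range z)"
      using z by (auto simp: block_multiples_def ell_infinity_def)
    have "weak_star_null z"
      by (rule weak_star_null_bounded_multiple[OF _ c zX(2) a])
        (use x in \<open>simp add: weak_star_null_not_weakly_null_def\<close>)
    moreover have "\<not> (\<lambda>n. \<phi> (z n)) \<longlonglongrightarrow> 0"
    proof -
      obtain m where "z m \<noteq> 0"
        using \<open>z \<noteq> 0\<close> by (auto simp: fun_eq_iff)
      then have nz_a: "a (i m) \<noteq> 0"
        by (auto simp: a)
      have "\<phi> (z n) = a (i n) * \<phi> (x n)" for n
        using \<phi>(1) dual by (simp add: functionals_on_def a)
      then have "{n \<in> {n. d \<le> norm (\<phi> (x n))}. i n = i m}
          \<subseteq> {n. norm (a (i m)) * d \<le> norm (\<phi> (z n))}"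
        by (auto simp: norm_mult intro!: mult_left_mono)
      then have "infinite {n. norm (a (i m)) * d \<le> norm (\<phi> (z n))}"
        using i infinite_super by blast
      then show ?thesis
        by (rule infinite_imp_not_tendsto_zero[rotated]) (use d nz_a in simp)
    qed
    ultimately show ?thesis
      using \<phi>(1) zX by (auto simp: weak_star_null_not_weakly_null_def weakly_null_on_def)
  qed
  moreover have "x \<in> block_multiples i x ?X"
    using xX by (intro mem_block_multiplesI[where a = "\<lambda>_. 1"]) simp_all
  ultimately show ?thesis
    using closed_infinite_dim_subspace_block_multiples[OF nz _ xX]
    by (intro exI[of _ "block_multiples i x ?X"]) auto
qed

text \<open>
  Keep only the terms on which a functional \<open>\<phi>\<close> has size at least \<open>d\<close>. By continuity of \<open>\<phi>\<close> at \<open>0\<close>,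
  these cannot be small in norm.
\<close>

lemma seminormalized_subsequence:
  fixes smul :: "'k::{real_normed_field, banach} \<Rightarrow> 'e::banach \<Rightarrow> 'e"
  assumes x: "x \<in> weak_star_null_not_weakly_null smul"
  obtains r where "strict_mono r" "seminormalized (x \<circ> r)"
    "x \<circ> r \<in> weak_star_null_not_weakly_null smul"
proof -
  have dual: "x n \<in> dual smul" for n
    using x by (auto simp: weak_star_null_not_weakly_null_def)
  have wsn: "weak_star_null x"
    using x by (auto simp: weak_star_null_not_weakly_null_def)
  obtain \<phi> where \<phi>: "\<phi> \<in> functionals_on dual_scale (dual smul)" "\<not> (\<lambda>n. \<phi> (x n)) \<longlonglongrightarrow> 0"
    using x by (auto simp: weak_star_null_not_weakly_null_def weakly_null_on_def)
  obtain d where d: "0 < d" and inf: "infinite {n. d \<le> norm (\<phi> (x n))}"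
    using not_tendsto_zeroE[OF \<phi>(2)] .
  obtain r :: "nat \<Rightarrow> nat" where r: "strict_mono r" "\<And>n. d \<le> norm (\<phi> (x (r n)))"
    using infinite_enumerate[OF inf] by blast
  have "\<phi> (0 + 0) = \<phi> 0 + \<phi> 0"
    using \<phi>(1) zero_mem_dual unfolding functionals_on_def by blast
  then have "\<phi> 0 = 0"
    by simp
  moreover have "continuous_on (dual smul) \<phi>"
    using \<phi>(1) by (simp add: functionals_on_def)
  ultimately obtain c where c: "0 < c" "\<And>f. f \<in> dual smul \<Longrightarrow> norm f < c \<Longrightarrow> norm (\<phi> f) < d"
    using d zero_mem_dual[of smul] unfolding continuous_on_iff dist_norm by (metis diff_zero)
  have "c \<le> norm (x (r n))" for n
    using c(2)[OF dual[of "r n"]] r(2)[of n] by force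
  then have "c \<le> (INF n. norm (x (r n)))"
    by (intro cINF_greatest) auto
  moreover obtain b where "\<And>n. norm (x n) \<le> b"
    using weak_star_null_bounded[OF wsn] by (auto simp: bounded_iff)
  ultimately have "seminormalized (x \<circ> r)"
    using c(1) by (auto simp: seminormalized_def intro!: bdd_aboveI2)
  moreover have "weak_star_null (x \<circ> r)"
    using wsn LIMSEQ_subseq_LIMSEQ[OF _ r(1)] by (auto simp: weak_star_null_def o_def)
  moreover have "\<not> (\<lambda>n. \<phi> ((x \<circ> r) n)) \<longlonglongrightarrow> 0"
    using r(2) by (intro infinite_imp_not_tendsto_zero[OF d]) simp
  ultimately show thesis
    using that r(1) \<phi>(1) dual
    by (auto simp: weak_star_null_not_weakly_null_def weakly_null_on_def)
qed

theorem corollary3p9: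
  fixes smul :: "'k::{real_normed_field, banach} \<Rightarrow> 'e::banach \<Rightarrow> 'e"
  assumes "banach_space_over smul"
    and "\<not> grothendieck_property smul"
  shows "almost_pointwise_spaceable dual_scale (ell_infinity (dual smul)) sup_norm
           (weak_star_null_not_weakly_null smul) \<and>
         (\<forall>x. x \<in> weak_star_null_not_weakly_null smul \<and> seminormalized x \<longrightarrow>
           (\<exists>W. closed_infinite_dim_subspace dual_scale (ell_infinity (dual smul)) sup_norm W \<and>
             W \<subseteq> weak_star_null_not_weakly_null smul \<union> {0} \<and> x \<in> W))"
proof (intro conjI allI impI)
  let ?B = "weak_star_null_not_weakly_null smul"
  show "almost_pointwise_spaceable dual_scale (ell_infinity (dual smul)) sup_norm ?B"
    unfolding almost_pointwise_spaceable_def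
  proof (intro conjI ballI)
    show "?B \<noteq> {}"
      using assms(2) by (auto simp: grothendieck_property_def weak_star_null_not_weakly_null_def)
    show "?B \<subseteq> ell_infinity (dual smul)"
      using weak_star_null_bounded
      by (auto simp: weak_star_null_not_weakly_null_def ell_infinity_def)
  next
    fix x
    assume "x \<in> ?B"
    then obtain r where r: "strict_mono r" "seminormalized (x \<circ> r)" "x \<circ> r \<in> ?B"
      by (rule seminormalized_subsequence)
    show "\<exists>W. closed_infinite_dim_subspace dual_scale (ell_infinity (dual smul)) sup_norm W \<and>
        W \<subseteq> ?B \<union> {0} \<and> (\<exists>r. strict_mono r \<and> x \<circ> r \<in> W)"
      using seminormalized_mem_closed_infinite_dim_subspace[OF r(3,2)] r(1) by blast
  qed
qed (use seminormalized_mem_closed_infinite_dim_subspace in blast)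

end
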